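(* Let $m\in\mathbb{N}^*$ and let $s_1,\ldots,s_m\in\mathbb{N}^*$ be integers with $\gcd(s_1,\ldots,s_m)=1$. Then $L(s_1,\ldots,s_m)\ge m-1$.
   Context: $\mathbb{N}^*$ is the set of positive integers. For integers $s_1,\ldots,s_m$ put $\hat{s}=\sum_{i=1}^m s_i$. A simple second-order cone representation of size $n\ge 1$ of the weighted geometric mean inequality $x_1^{s_1}\cdots x_m^{s_m}\ge x_{m+1}^{\hat{s}}$ is a set of $n$ quadratic inequalities $x_{i_k}x_{j_k}\ge x_{m+k}^2$, $k=1,\ldots,n$, with $i_k,j_k\in\{1,2,\ldots,m+n\}$, such that for all nonnegative reals $x_1,\ldots,x_{m+1}$: $x_1^{s_1}\cdots x_m^{s_m}\ge x_{m+1}^{\hat{s}}$ holds if and only if there exist nonnegative reals $x_{m+2},\ldots,x_{m+n}$ (the $n-1$ auxiliary variables) with $x_{i_k}x_{j_k}\ge x_{m+k}^2$ for all $k=1,\ldots,n$. $L(s_1,\ldots,s_m)$ denotes the minimum size $n$ of a simple second-order cone representation of $x_1^{s_1}\cdots x_m^{s_m}\ge x_{m+1}^{\hat{s}}$. *)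

theory Defs
  imports Complex_Main
begin

text \<open>Variables are indexed from 1 as values of a function \<open>x\<close>; only the indices
  \<open>1, \<dots>, m + n\<close> of \<open>x\<close> and \<open>1, \<dots>, m\<close> of the weights \<open>s\<close> matter.\<close>

definition weighted_geom_mean_ineq :: "nat \<Rightarrow> (nat \<Rightarrow> nat) \<Rightarrow> (nat \<Rightarrow> real) \<Rightarrow> bool" where
  "weighted_geom_mean_ineq m s x \<longleftrightarrow>
     (\<Prod>i=1..m. x i ^ s i) \<ge> x (m + 1) ^ (\<Sum>i=1..m. s i)"

text \<open>The \<open>k\<close>-th quadratic inequality is \<open>x (I k) * x (J k) \<ge> (x (m + k))\<^sup>2\<close>. The function \<open>y\<close>
  extends the given values \<open>x 1, \<dots>, x (m + 1)\<close> by values for the \<open>n - 1\<close> auxiliary variables.\<close>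

definition simple_socp_rep ::
    "nat \<Rightarrow> (nat \<Rightarrow> nat) \<Rightarrow> nat \<Rightarrow> (nat \<Rightarrow> nat) \<Rightarrow> (nat \<Rightarrow> nat) \<Rightarrow> bool" where
  "simple_socp_rep m s n I J \<longleftrightarrow>
     n \<ge> 1 \<and>
     (\<forall>k\<in>{1..n}. I k \<in> {1..m + n} \<and> J k \<in> {1..m + n}) \<and>
     (\<forall>x. (\<forall>i\<in>{1..m + 1}. x i \<ge> 0) \<longrightarrow>
        (weighted_geom_mean_ineq m s x \<longleftrightarrow>
         (\<exists>y. (\<forall>i\<in>{1..m + 1}. y i = x i) \<and>
              (\<forall>i\<in>{m + 2..m + n}. y i \<ge> 0) \<and>
              (\<forall>k\<in>{1..n}. y (I k) * y (J k) \<ge> (y (m + k))\<^sup>2))))"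

text \<open>For positive weights a representation always exists: pad the left-hand side with copies of
  \<open>x (m + 1)\<close> to a power of two (at least 2) of factors and combine them in a balanced binary
  tree. Hence the minimum below is attained.\<close>

definition min_socp_size :: "nat \<Rightarrow> (nat \<Rightarrow> nat) \<Rightarrow> nat" where
  "min_socp_size m s = (LEAST n. \<exists>I J. simple_socp_rep m s n I J)"

end

theory Submission
  imports Defs
begin

text \<open>
  View a representation as a digraph on the variables \<open>1, \<dots>, m + n\<close>: the \<open>k\<close>-th inequality gives
  the variable \<open>m + k\<close> the two children \<open>I k\<close> and \<open>J k\<close>, and the variables \<open>1, \<dots>, m\<close> are the
  leaves.

  Every leaf must be reachable from the root \<open>m + 1\<close>. Take a feasible point with all of
  \<open>x 1, \<dots>, x (m + 1)\<close> equal to 1 and set every unreachable variable to 0. The inequalities at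
  reachable variables only involve reachable variables and are untouched, and the others become
  \<open>\<dots> \<ge> 0\<close>. So the new point is feasible with \<open>x (m + 1) = 1\<close>, and no \<open>x i\<close> with \<open>s i > 0\<close>
  can have become 0. This is \<open>leaves_in_closed_set\<close>.

  Now count. If \<open>r\<close> of the \<open>n\<close> inequalities sit at reachable variables, then there are \<open>m + r\<close>
  reachable variables, and each of them except the root is one of the at most \<open>2 * r\<close> children of
  reachable variables. Hence \<open>m + r \<le> 1 + 2 * r\<close>, so \<open>m - 1 \<le> r \<le> n\<close> (\<open>socp_rep_size_ge\<close>).

  As \<open>min_socp_size\<close> is a least number, the bound transfers to it only if some representation
  exists. Pad the factors of the left-hand side with copies of \<open>x (m + 1)\<close> to \<open>2 ^ h\<close> factors and
  place them at the bottom of a complete binary tree in heap order, so that \<open>j\<close> has children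
  \<open>2 * j\<close> and \<open>2 * j + 1\<close>. The quadratic inequalities say that every inner value is at most the
  geometric mean of its children, and multiplying them up level by level compares the root with
  the geometric mean of the bottom level (\<open>socp_rep_exists\<close>).
\<close>

section \<open>The lower bound for a given representation\<close>

text \<open>Zeroing all variables outside a set that is closed under taking children preserves
  feasibility. Applied to a point with \<open>x (m + 1) = 1\<close>, this would break the geometric mean
  inequality if \<open>x i\<close> were among the zeroed variables.\<close>

lemma leaves_in_closed_set:
  assumes rep: "simple_socp_rep m s n I J"
    and root: "m + 1 \<in> R"
    and closed: "\<And>k. k \<in> {1..n} \<Longrightarrow> m + k \<in> R \<Longrightarrow> I k \<in> R \<and> J k \<in> R"
    and i: "i \<in> {1..m}" and si: "s i \<ge> 1"
  shows "i \<in> R"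
proof (rule ccontr)
  assume notin: "i \<notin> R"
  have n1: "n \<ge> 1" and IJ: "\<And>k. k \<in> {1..n} \<Longrightarrow> I k \<in> {1..m + n} \<and> J k \<in> {1..m + n}"
    using rep unfolding simple_socp_rep_def by auto
  have equiv: "weighted_geom_mean_ineq m s x \<longleftrightarrow>
         (\<exists>y. (\<forall>i\<in>{1..m + 1}. y i = x i) \<and>
              (\<forall>i\<in>{m + 2..m + n}. y i \<ge> 0) \<and>
              (\<forall>k\<in>{1..n}. y (I k) * y (J k) \<ge> (y (m + k))\<^sup>2))"
    if "\<forall>i\<in>{1..m + 1}. x i \<ge> 0" for x
    using rep that unfolding simple_socp_rep_def by blast
  have "weighted_geom_mean_ineq m s (\<lambda>_. 1)"
    by (simp add: weighted_geom_mean_ineq_def)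
  then obtain y where y1: "\<forall>i\<in>{1..m + 1}. y i = 1"
    and y2: "\<forall>i\<in>{m + 2..m + n}. y i \<ge> (0::real)"
    and y3: "\<forall>k\<in>{1..n}. y (I k) * y (J k) \<ge> (y (m + k))\<^sup>2"
    using equiv[of "\<lambda>_. 1"] by auto
  have y_nonneg: "y j \<ge> 0" if "j \<in> {1..m + n}" for j
  proof (cases "j \<le> m + 1")
    case True
    then show ?thesis using y1 that by simp
  next
    case False
    then show ?thesis using y2 that by simp
  qed
  define z where "z j = (if j \<in> R then y j else 0)" for j
  have z_nonneg: "z j \<ge> 0" if "j \<in> {1..m + n}" for j
    using y_nonneg[OF that] by (simp add: z_def)
  have "z (I k) * z (J k) \<ge> (z (m + k))\<^sup>2" if k: "k \<in> {1..n}" for k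
  proof (cases "m + k \<in> R")
    case True
    then show ?thesis using closed[OF k] y3 k by (simp add: z_def)
  next
    case False
    then show ?thesis using z_nonneg IJ[OF k] by (simp add: z_def[of "m + k"])
  qed
  moreover have "\<forall>i\<in>{1..m + 1}. z i \<ge> 0" "\<forall>i\<in>{m + 2..m + n}. z i \<ge> 0"
    using z_nonneg n1 by auto
  ultimately have "weighted_geom_mean_ineq m s z"
    using equiv[of z] by blast
  moreover have "(\<Prod>i=1..m. z i ^ s i) = 0"
  proof (rule prod_zero)
    have "z i ^ s i = 0"
      using notin si by (simp add: z_def)
    then show "\<exists>i\<in>{1..m}. z i ^ s i = 0"
      using i by blast
  qed simp
  moreover have "z (m + 1) = 1"
    using root y1 by (simp add: z_def)
  ultimately show False
    unfolding weighted_geom_mean_ineq_def by (simp del: prod_zero_iff)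
qed

lemma socp_rep_size_ge:
  assumes rep: "simple_socp_rep m s n I J"
    and pos: "\<forall>i\<in>{1..m}. s i \<ge> 1"
  shows "m - 1 \<le> n"
proof -
  define E where "E = {(m + k, I k) | k. k \<in> {1..n}} \<union> {(m + k, J k) | k. k \<in> {1..n}}"
  define R where "R = {v. (m + 1, v) \<in> E\<^sup>*}"
  define K where "K = {k \<in> {1..n}. m + k \<in> R}"
  have root: "m + 1 \<in> R"
    by (simp add: R_def)
  have closed: "I k \<in> R \<and> J k \<in> R" if "k \<in> {1..n}" "m + k \<in> R" for k
    using that unfolding R_def E_def by (auto intro: rtrancl_into_rtrancl)
  have leaves: "{1..m} \<subseteq> R"
    using leaves_in_closed_set[OF rep root closed] pos by blast
  have "K \<subseteq> {1..n}"
    by (auto simp: K_def)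
  then have finK: "finite K" and Kn: "card K \<le> n"
    using card_mono[of "{1..n}" K] by (auto dest: finite_subset)
  have R_sub: "R \<subseteq> insert (m + 1) (I ` K \<union> J ` K)"
  proof
    fix v assume "v \<in> R"
    then have "(m + 1, v) \<in> E\<^sup>*" by (simp add: R_def)
    then show "v \<in> insert (m + 1) (I ` K \<union> J ` K)"
      by (cases rule: rtranclE) (auto simp: E_def K_def R_def)
  qed
  have "m + card K = card ({1..m} \<union> (+) m ` K)"
    using finK by (subst card_Un_disjoint) (auto simp: card_image K_def)
  also have "\<dots> \<le> card (insert (m + 1) (I ` K \<union> J ` K))"
    using leaves R_sub finK by (intro card_mono) (auto simp: K_def)
  also have "\<dots> \<le> 1 + card (I ` K \<union> J ` K)"
    using card_insert_le_m1 by (simp add: card_insert_if finK)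
  also have "card (I ` K \<union> J ` K) \<le> card K + card K"
    using card_Un_le[of "I ` K" "J ` K"] card_image_le[OF finK, of I] card_image_le[OF finK, of J]
    by linarith
  finally show ?thesis using Kn by linarith
qed

section \<open>Complete binary trees in heap order\<close>

text \<open>Every value of the next level is the left or the right child of exactly one value of the
  current level.\<close>

lemma prod_heap_level:
  fixes w :: "nat \<Rightarrow> 'a::comm_monoid_mult"
  shows "(\<Prod>j\<in>{a..<a + l}. w (2 * j) * w (2 * j + 1)) = (\<Prod>j\<in>{2 * a..<2 * a + 2 * l}. w j)"
  by (induction l) (simp_all add: mult.assoc)

lemma heap_root_le_bottom:
  fixes w :: "nat \<Rightarrow> real"
  assumes nonneg: "\<And>j. 1 \<le> j \<Longrightarrow> j < 2 ^ Suc h \<Longrightarrow> w j \<ge> 0"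
    and le: "\<And>j. 1 \<le> j \<Longrightarrow> j < 2 ^ h \<Longrightarrow> (w j)\<^sup>2 \<le> w (2 * j) * w (2 * j + 1)"
  shows "w 1 ^ 2 ^ h \<le> (\<Prod>j\<in>{2 ^ h..<2 ^ Suc h}. w j)"
  using assms
proof (induction h)
  case 0
  have "{1..<2} = {1::nat}" by auto
  then show ?case by simp
next
  case (Suc h)
  have "w 1 ^ 2 ^ h \<le> (\<Prod>j\<in>{2 ^ h..<2 ^ Suc h}. w j)"
    using Suc.prems by (intro Suc.IH) simp_all
  moreover have "w 1 \<ge> 0" using Suc.prems(1)[of 1] one_less_power[of "2::nat" "Suc (Suc h)"] by simp
  ultimately have "(w 1 ^ 2 ^ h)\<^sup>2 \<le> (\<Prod>j\<in>{2 ^ h..<2 ^ Suc h}. w j)\<^sup>2"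
    by (intro power_mono) auto
  also have "\<dots> = (\<Prod>j\<in>{2 ^ h..<2 ^ Suc h}. (w j)\<^sup>2)"
    by (rule prod_power_distrib)
  also have "\<dots> \<le> (\<Prod>j\<in>{2 ^ h..<2 ^ Suc h}. w (2 * j) * w (2 * j + 1))"
  proof (intro prod_mono conjI Suc.prems(2) zero_le_power2)
    fix j :: nat assume "j \<in> {2 ^ h..<2 ^ Suc h}"
    moreover have "(1::nat) \<le> 2 ^ h" by simp
    ultimately show "1 \<le> j" "j < 2 ^ Suc h" by auto
  qed
  also have "\<dots> = (\<Prod>j\<in>{2 ^ Suc h..<2 ^ Suc (Suc h)}. w j)"
    using prod_heap_level[of w "2 ^ h" "2 ^ h"] by (simp add: mult_2)
  finally show ?case by (simp add: power_mult[symmetric] mult.commute)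
qed

text \<open>Filling the tree with geometric means from the bottom upwards gives equality at the root.\<close>

lemma heap_geometric_means:
  fixes a :: "nat \<Rightarrow> real"
  assumes "\<And>j. a j \<ge> 0"
  obtains v where "\<And>j. j \<ge> 2 ^ h \<Longrightarrow> v j = a j" and "\<And>j. v j \<ge> 0"
    and "\<And>j. 1 \<le> j \<Longrightarrow> j < 2 ^ h \<Longrightarrow> (v j)\<^sup>2 = v (2 * j) * v (2 * j + 1)"
    and "v 1 ^ 2 ^ h = (\<Prod>j\<in>{2 ^ h..<2 ^ Suc h}. a j)"
  using assms
proof (induction h arbitrary: a thesis)
  case 0
  have "{1..<2} = {1::nat}" by auto
  then show ?case using 0(2) by (intro 0(1)[of a]) simp_all
next
  case (Suc h)
  define b where "b j = (if j < 2 ^ Suc h then sqrt (a (2 * j) * a (2 * j + 1)) else a j)" for j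
  have b0: "b j \<ge> 0" for j
    using Suc.prems(2) by (simp add: b_def)
  have b2: "(b j)\<^sup>2 = a (2 * j) * a (2 * j + 1)" if "j < 2 ^ Suc h" for j
    using Suc.prems(2) that by (simp add: b_def)
  obtain v where v: "\<And>j. j \<ge> 2 ^ h \<Longrightarrow> v j = b j" "\<And>j. v j \<ge> 0"
    "\<And>j. 1 \<le> j \<Longrightarrow> j < 2 ^ h \<Longrightarrow> (v j)\<^sup>2 = v (2 * j) * v (2 * j + 1)"
    "v 1 ^ 2 ^ h = (\<Prod>j\<in>{2 ^ h..<2 ^ Suc h}. b j)"
    by (rule Suc.IH[where a = b, OF _ b0]) (rule that)
  have bottom: "v j = a j" if "j \<ge> 2 ^ Suc h" for j
    using that v(1)[of j] by (simp add: b_def)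
  show ?case
  proof (rule Suc.prems(1)[of v])
    fix j :: nat
    show "v j = a j" if "j \<ge> 2 ^ Suc h" using bottom[OF that] .
    show "v j \<ge> 0" by (rule v(2))
    show "(v j)\<^sup>2 = v (2 * j) * v (2 * j + 1)" if "1 \<le> j" "j < 2 ^ Suc h"
    proof (cases "j < 2 ^ h")
      case True
      then show ?thesis using v(3) that by simp
    next
      case False
      then show ?thesis using v(1)[of j] b2[of j] that by (simp add: bottom)
    qed
  next
    have "v 1 ^ 2 ^ Suc h = (v 1 ^ 2 ^ h)\<^sup>2"
      by (simp add: power_mult[symmetric] mult.commute)
    also have "\<dots> = (\<Prod>j\<in>{2 ^ h..<2 ^ Suc h}. (b j)\<^sup>2)"
      unfolding v(4) by (rule prod_power_distrib)
    also have "\<dots> = (\<Prod>j\<in>{2 ^ h..<2 ^ Suc h}. a (2 * j) * a (2 * j + 1))"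
      by (intro prod.cong b2) auto
    also have "\<dots> = (\<Prod>j\<in>{2 ^ Suc h..<2 ^ Suc (Suc h)}. a j)"
      using prod_heap_level[of a "2 ^ h" "2 ^ h"] by (simp add: mult_2)
    finally show "v 1 ^ 2 ^ Suc h = (\<Prod>j\<in>{2 ^ Suc h..<2 ^ Suc (Suc h)}. a j)" .
  qed
qed

section \<open>Existence of a representation\<close>

text \<open>The labels of the bottom level of the tree: \<open>s i\<close> copies of each \<open>i\<close> in \<open>1, \<dots>, m\<close>, and
  \<open>m + 1\<close> for the rest.\<close>

lemma padded_factor_labels:
  assumes "(\<Sum>i=1..m. s i) \<le> N"
  obtains leaf :: "nat \<Rightarrow> nat" where "\<And>j. j < N \<Longrightarrow> leaf j \<in> {1..m + 1}"
    and "\<And>x :: nat \<Rightarrow> real. (\<Prod>j<N. x (leaf j)) =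
           (\<Prod>i=1..m. x i ^ s i) * x (m + 1) ^ (N - (\<Sum>i=1..m. s i))"
proof -
  define ys where "ys = concat (map (\<lambda>i. replicate (s i) i) [1..<Suc m])"
  define xs where "xs = ys @ replicate (N - (\<Sum>i=1..m. s i)) (m + 1)"
  have ys_sum: "length ys = (\<Sum>i=1..m. s i)"
    unfolding ys_def by (induction m) simp_all
  then have len: "length xs = N"
    using assms by (simp add: xs_def)
  have ys_set: "set ys \<subseteq> {1..m + 1}"
    by (auto simp: ys_def)
  then have xs_set: "set xs \<subseteq> {1..m + 1}"
    by (auto simp: xs_def)
  have ys_prod: "prod_list (map x ys) = (\<Prod>i=1..m. x i ^ s i)" for x :: "nat \<Rightarrow> real"
    unfolding ys_def by (induction m) (simp_all add: map_replicate)
  show ?thesis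
  proof
    show "xs ! j \<in> {1..m + 1}" if "j < N" for j
      using that len xs_set nth_mem[of j xs] by blast
    fix x :: "nat \<Rightarrow> real"
    have "(\<Prod>j<N. x (xs ! j)) = prod_list (map x xs)"
      using len by (simp add: prod.list_conv_set_nth atLeast0LessThan)
    also have "\<dots> = (\<Prod>i=1..m. x i ^ s i) * x (m + 1) ^ (N - (\<Sum>i=1..m. s i))"
      by (simp add: xs_def ys_prod map_replicate)
    finally show "(\<Prod>j<N. x (xs ! j)) =
        (\<Prod>i=1..m. x i ^ s i) * x (m + 1) ^ (N - (\<Sum>i=1..m. s i))" .
  qed
qed

text \<open>The padding can be cancelled: at \<open>t = 0\<close> both sides hold trivially because the exponents
  are positive.\<close>

lemma padded_ineq_iff:
  fixes P t :: real
  assumes "t \<ge> 0" "1 \<le> S" "S \<le> N" "P \<ge> 0"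
  shows "t ^ N \<le> P * t ^ (N - S) \<longleftrightarrow> t ^ S \<le> P"
proof -
  have N: "t ^ N = t ^ S * t ^ (N - S)"
    using assms(3) by (simp add: power_add[symmetric])
  show ?thesis
  proof (cases "t = 0")
    case True
    then show ?thesis using assms by (simp add: power_0_left)
  next
    case False
    then show ?thesis using assms(1) by (simp add: N)
  qed
qed

text \<open>The tree has the inner nodes \<open>1, \<dots>, N - 1\<close>, where \<open>j\<close> stands for the variable \<open>m + j\<close>, and the
  bottom nodes \<open>N, \<dots>, 2 * N - 1\<close>.\<close>

lemma socp_rep_exists:
  assumes m: "m \<ge> 1" and pos: "\<forall>i\<in>{1..m}. s i \<ge> 1"
  shows "\<exists>n I J. simple_socp_rep m s n I J"
proof -
  define S where "S = (\<Sum>i=1..m. s i)"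
  have "s 1 \<le> S"
    unfolding S_def using m by (intro member_le_sum) auto
  then have S1: "1 \<le> S" using pos m by force
  \<comment> \<open>Any depth \<open>h \<ge> 1\<close> with \<open>S \<le> 2 ^ h\<close> would do; \<open>S\<close> itself is such a depth.\<close>
  define N :: nat where "N = 2 ^ S"
  have SN: "S \<le> N" using less_exp[of S] by (simp add: N_def)
  have N2: "2 \<le> N" using power_increasing[OF S1, of "2::nat"] by (simp add: N_def)
  obtain leaf where leaf: "\<And>j. j < N \<Longrightarrow> leaf j \<in> {1..m + 1}"
    and leaf_prod: "\<And>x :: nat \<Rightarrow> real.
      (\<Prod>j<N. x (leaf j)) = (\<Prod>i=1..m. x i ^ s i) * x (m + 1) ^ (N - S)"
    by (rule padded_factor_labels[of s m N, folded S_def, OF SN]) (rule that)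
  define var where "var j = (if j < N then m + j else leaf (j - N))" for j
  have var_range: "var j \<in> {1..m + (N - 1)}" if "1 \<le> j" "j < 2 * N" for j
  proof (cases "j < N")
    case True
    then show ?thesis using that by (simp add: var_def)
  next
    case False
    then have "leaf (j - N) \<in> {1..m + 1}" using that by (intro leaf) linarith
    then show ?thesis using False N2 by (auto simp: var_def)
  qed
  have bottom_prod: "(\<Prod>j\<in>{N..<2 * N}. x (leaf (j - N))) =
      (\<Prod>i=1..m. x i ^ s i) * x (m + 1) ^ (N - S)" for x :: "nat \<Rightarrow> real"
    using prod.shift_bounds_nat_ivl[of "\<lambda>j. x (leaf (j - N))" 0 N N]
    by (simp add: leaf_prod mult_2 atLeast0LessThan)
  have ineq_iff: "weighted_geom_mean_ineq m s x \<longleftrightarrow>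
      x (m + 1) ^ N \<le> (\<Prod>j\<in>{N..<2 * N}. x (leaf (j - N)))"
    if "\<forall>i\<in>{1..m + 1}. x i \<ge> 0" for x
    unfolding weighted_geom_mean_ineq_def bottom_prod
    using that S1 SN
    by (subst padded_ineq_iff) (auto simp: S_def intro!: prod_nonneg)
  have "simple_socp_rep m s (N - 1) (\<lambda>k. var (2 * k)) (\<lambda>k. var (2 * k + 1))"
    unfolding simple_socp_rep_def
  proof (intro conjI allI impI ballI)
    show "1 \<le> N - 1" using N2 by simp
    show "var (2 * k) \<in> {1..m + (N - 1)}" if "k \<in> {1..N - 1}" for k
      using that by (intro var_range) auto
    show "var (2 * k + 1) \<in> {1..m + (N - 1)}" if "k \<in> {1..N - 1}" for k
      using that by (intro var_range) auto
  next
    fix x :: "nat \<Rightarrow> real"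
    assume x0: "\<forall>i\<in>{1..m + 1}. x i \<ge> 0"
    show "weighted_geom_mean_ineq m s x \<longleftrightarrow>
         (\<exists>y. (\<forall>i\<in>{1..m + 1}. y i = x i) \<and>
              (\<forall>i\<in>{m + 2..m + (N - 1)}. y i \<ge> 0) \<and>
              (\<forall>k\<in>{1..N - 1}. y (var (2 * k)) * y (var (2 * k + 1)) \<ge> (y (m + k))\<^sup>2))"
      (is "?W \<longleftrightarrow> (\<exists>y. ?F y)")
    proof
      assume W: ?W
      \<comment> \<open>The value 0 is a dummy beyond the bottom level, where \<open>leaf\<close> is unconstrained.\<close>
      define a where "a j = (if j - N < N then x (leaf (j - N)) else 0)" for j
      have a0: "a j \<ge> 0" for j using leaf x0 by (simp add: a_def)
      obtain v where v: "\<And>j. j \<ge> N \<Longrightarrow> v j = a j" "\<And>j. v j \<ge> 0"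
        "\<And>j. 1 \<le> j \<Longrightarrow> j < N \<Longrightarrow> (v j)\<^sup>2 = v (2 * j) * v (2 * j + 1)"
        "v 1 ^ N = (\<Prod>j\<in>{N..<2 * N}. a j)"
        by (rule heap_geometric_means
            [where a = a and h = S, OF a0, unfolded power_Suc, folded N_def]) (rule that)
      have "(\<Prod>j\<in>{N..<2 * N}. a j) = (\<Prod>j\<in>{N..<2 * N}. x (leaf (j - N)))"
        by (intro prod.cong) (auto simp: a_def)
      then have "x (m + 1) ^ N \<le> v 1 ^ N"
        using W ineq_iff[OF x0] v(4) by simp
      then have root: "x (m + 1) \<le> v 1"
        using v(2) N2 by (simp add: power_mono_iff x0)
      \<comment> \<open>The prescribed root value replaces the geometric mean \<open>v 1\<close>. It is not larger, so the
          inequality at the root survives.\<close>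
      define y where "y i = (if i \<le> m + 1 then x i else v (i - m))" for i
      have y_var: "y (var j) = v j" if "2 \<le> j" "j < 2 * N" for j
        using that leaf[of "j - N"] v(1)[of j] by (auto simp: y_def var_def a_def)
      have y_inner: "(y (m + k))\<^sup>2 \<le> (v k)\<^sup>2" if "1 \<le> k" for k
        using that root x0 v(2) by (cases "k = 1") (auto simp: y_def intro!: power_mono)
      have "?F y"
      proof (intro conjI ballI)
        fix k assume k: "k \<in> {1..N - 1}"
        then have "(y (m + k))\<^sup>2 \<le> v (2 * k) * v (2 * k + 1)"
          using y_inner[of k] v(3)[of k] N2 by auto
        also have "\<dots> = y (var (2 * k)) * y (var (2 * k + 1))"
          using k N2 y_var[of "2 * k"] y_var[of "2 * k + 1"] by auto
        finally show "(y (m + k))\<^sup>2 \<le> y (var (2 * k)) * y (var (2 * k + 1))" .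
      qed (auto simp: y_def v(2))
      then show "\<exists>y. ?F y" by (rule exI[of _ y])
    next
      assume "\<exists>y. ?F y"
      then obtain y where y: "\<forall>i\<in>{1..m + 1}. y i = x i" "\<forall>i\<in>{m + 2..m + (N - 1)}. y i \<ge> 0"
        "\<forall>k\<in>{1..N - 1}. y (var (2 * k)) * y (var (2 * k + 1)) \<ge> (y (m + k))\<^sup>2"
        by blast
      have y_nonneg: "y i \<ge> 0" if "i \<in> {1..m + (N - 1)}" for i
      proof (cases "i \<le> m + 1")
        case True
        then show ?thesis using y(1) x0 that by simp
      next
        case False
        then show ?thesis using y(2) that by simp
      qed
      have "y (var 1) ^ 2 ^ S \<le> (\<Prod>j\<in>{2 ^ S..<2 ^ Suc S}. y (var j))"
      proof (rule heap_root_le_bottom)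
        fix j :: nat assume j: "1 \<le> j"
        show "y (var j) \<ge> 0" if "j < 2 ^ Suc S"
          using that j by (intro y_nonneg var_range) (auto simp: N_def)
        show "(y (var j))\<^sup>2 \<le> y (var (2 * j)) * y (var (2 * j + 1))" if "j < 2 ^ S"
        proof -
          have "var j = m + j" "j \<in> {1..N - 1}"
            using that j by (auto simp: var_def N_def)
          then show ?thesis using y(3) by simp
        qed
      qed
      moreover have "y (var 1) = x (m + 1)"
        using y(1) N2 by (simp add: var_def)
      moreover have "(\<Prod>j\<in>{N..<2 * N}. y (var j)) = (\<Prod>j\<in>{N..<2 * N}. x (leaf (j - N)))"
      proof (intro prod.cong refl)
        fix j assume "j \<in> {N..<2 * N}"
        then show "y (var j) = x (leaf (j - N))"
          using leaf[of "j - N"] y(1) by (auto simp: var_def)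
      qed
      ultimately show ?W
        using ineq_iff[OF x0] by (simp add: N_def)
    qed
  qed
  then show ?thesis by blast
qed

section \<open>The lower bound for the minimum size\<close>

theorem theorem6:
  fixes m :: nat and s :: "nat \<Rightarrow> nat"
  assumes "m \<ge> 1"
    and "\<forall>i\<in>{1..m}. s i \<ge> 1"
    and "Gcd (s ` {1..m}) = 1"
  shows "min_socp_size m s \<ge> m - 1"
proof -
  have "\<exists>I J. simple_socp_rep m s (min_socp_size m s) I J"
    unfolding min_socp_size_def using socp_rep_exists[OF assms(1,2)] by (rule LeastI_ex)
  then show ?thesis
    using socp_rep_size_ge assms(2) by blast
qed

end
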